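(* Let $q\ge 2$ be an even integer and let $m>k\ge 0$ be integers. Let $0\le j_0<j_1<\cdots<j_{k-1}<m$ be a list of $k$ indices, and write $\boldsymbol{x}=(x_{j_0},x_{j_1},\dots,x_{j_{k-1}})$. Let $f:\{0,1\}^m\rightarrow\mathbb{Z}_q$ be a generalized Boolean function such that for each $\boldsymbol{d}\in\{0,1\}^k$ the restricted function $f|_{\boldsymbol{x}=\boldsymbol{d}}$ is quadratic and its graph $G(f|_{\boldsymbol{x}=\boldsymbol{d}})$ is a path in $m-k$ vertices. Then the polyphase sequence $\Psi(f)$ lies in a complementary set of size $2^{k+1}$, and the PMEPR of $\Psi(f)$ is at most $2^{k+1}$.
   Context: A generalized Boolean function is a map $f:\{0,1\}^m\to\mathbb{Z}_q$ in the variables $x_0,\dots,x_{m-1}$; it has a unique polynomial form (algebraic normal form) $f=\sum_{i\in\{0,1\}^m}c_i\prod_{\alpha=0}^{m-1}x_\alpha^{i_\alpha}$ with $c_i\in\mathbb{Z}_q$. For $0\le i<2^m$ with binary expansion $i=\sum_{\alpha=0}^{m-1}i_\alpha2^\alpha$, $i_\alpha\in\{0,1\}$, put $f_i=f(i_0,\dots,i_{m-1})$. The polyphase sequence associated with $f$ is $\Psi(f)=(\xi^{f_0},\xi^{f_1},\dots,\xi^{f_{2^m-1}})$ with $\xi=e^{2\pi\sqrt{-1}/q}$. Restriction: for $\boldsymbol{d}=(d_0,\dots,d_{k-1})\in\{0,1\}^k$, $f|_{\boldsymbol{x}=\boldsymbol{d}}$ is the generalized Boolean function in the remaining $m-k$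 variables obtained by substituting $x_{j_\alpha}=d_\alpha$ for all $0\le\alpha<k$ (for $k=0$ it is $f$ itself). The remaining variables keep their original indices. Quadratic functions and graphs: a function in $n$ variables $x_{i_0},\dots,x_{i_{n-1}}$ is called quadratic if it has the form $\sum_{0\le j<l<n}b_{jl}x_{i_j}x_{i_l}+a(x_{i_0},\dots,x_{i_{n-1}})$ with $b_{jl}\in\mathbb{Z}_q$ and $a$ an affine form over $\mathbb{Z}_q$ (a linear form plus a constant). Its graph is the labeled graph with vertices $i_0,\dots,i_{n-1}$ in which the edge between $i_j$ and $i_l$ is labeled $b_{jl}$. For $q$ even, this graph is called a path in $n$ vertices if $n=1$, or if $n\ge 2$ and the function is of the form $\frac{q}{2}\sum_{\alpha=0}^{n-2}x_{i_{\pi(\alpha)}}x_{i_{\pi(\alpha+1)}}+a(x_{i_0},\dots,x_{i_{n-1}})$ for some permutation $\pi$ of $\{0,\dots,n-1\}$ and some affine form $a$ over $\mathbb{Z}_q$. Complementary sets: for a complex sequence $\boldsymbol{A}=(A_0,\dots,A_{n-1})$ the aperiodic auto-correlation at displacement $\ell\in\mathbb{Z}$ is $A(\boldsymbol{A})(\ell)=\sum_{i=0}^{n-\ell-1}A_{i+\ell}A_i^*$ for $0\le\ell<n$, $A(\boldsymbol{A})(\ell)=\sum_{i=0}^{n+\ell-1}A_iA_{i-\ell}^*$ for $-n<\ell<0$, and $0$ otherwise ($^*$ is complex conjugation). A set of $N$ sequences $\{\boldsymbol{A}^0,\dots,\boldsymbol{A}^{N-1}\}$ of the same length is a complementary set of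 size $N$ if $\sum_{i=0}^{N-1}A(\boldsymbol{A}^i)(\ell)=0$ for each $\ell\ne 0$. (Here the sequences are polyphase sequences of length $2^m$, with entries powers of $\xi$.) PMEPR: for a sequence $\boldsymbol{C}=(C_0,\dots,C_{n-1})$ with entries powers of $\xi$, let $S(\boldsymbol{C})(\theta)=\sum_{i=0}^{n-1}C_i e^{2\pi\sqrt{-1}(i+\zeta)\theta}$ for $0\le\theta<1$, with $\zeta$ a fixed positive constant, and $\mathrm{PMEPR}(\boldsymbol{C})=\frac1n\sup_{0\le\theta<1}|S(\boldsymbol{C})(\theta)|^2$. *)

theory Defs
  imports
    Complex_Main
    "HOL-Library.FuncSet"
    "HOL-Combinatorics.Permutations"
    "HOL-Number_Theory.Cong"
begin

section \<open>Generalized Boolean functions\<close>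

text \<open>
  The ring of integers modulo \<open>q\<close> is represented by the residues \<open>{0..<q}\<close>; identities in it are
  congruences modulo \<open>q\<close>, so integer coefficients stand for their residue classes.
  A function in the variables \<open>x\<^sub>i\<close>, \<open>i \<in> I\<close>, takes as arguments the points of \<open>cube I\<close>. Indexing
  points by the set \<open>I\<close> itself lets the variables of a restricted function keep their indices.
\<close>

definition cube :: "nat set \<Rightarrow> (nat \<Rightarrow> int) set" where
  "cube I = I \<rightarrow>\<^sub>E {0, 1}"

definition gen_bool_fun :: "int \<Rightarrow> nat set \<Rightarrow> ((nat \<Rightarrow> int) \<Rightarrow> int) \<Rightarrow> bool" where
  "gen_bool_fun q I f \<longleftrightarrow> f \<in> cube I \<rightarrow> {0..<q}"

text \<open>
  Substitution of \<open>d \<alpha>\<close> for the variable with index \<open>j \<alpha>\<close>, for all \<open>\<alpha> < k\<close>, where \<open>j\<close> is injective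
  on \<open>{..<k}\<close>. If \<open>f\<close> is a function on \<open>cube I\<close>, the result is one on \<open>cube (I - j ` {..<k})\<close>.
\<close>

definition restrict_vars ::
  "nat \<Rightarrow> (nat \<Rightarrow> nat) \<Rightarrow> (nat \<Rightarrow> int) \<Rightarrow> ((nat \<Rightarrow> int) \<Rightarrow> int) \<Rightarrow> (nat \<Rightarrow> int) \<Rightarrow> int" where
  "restrict_vars k j d f =
     (\<lambda>y. f (\<lambda>i. if i \<in> j ` {..<k} then d (inv_into {..<k} j i) else y i))"

section \<open>Quadratic functions and their graphs\<close>

definition affine_form :: "nat set \<Rightarrow> ((nat \<Rightarrow> int) \<Rightarrow> int) \<Rightarrow> bool" where
  "affine_form I a \<longleftrightarrow> (\<exists>u c. \<forall>x. a x = (\<Sum>i\<in>I. u i * x i) + c)"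

text \<open>The increasing enumeration \<open>i\<^sub>0 < i\<^sub>1 < \<dots>\<close> of a finite set \<open>I\<close> of variable indices.\<close>

definition var_idx :: "nat set \<Rightarrow> nat \<Rightarrow> nat" where
  "var_idx I j = sorted_list_of_set I ! j"

definition quadratic :: "int \<Rightarrow> nat set \<Rightarrow> ((nat \<Rightarrow> int) \<Rightarrow> int) \<Rightarrow> bool" where
  "quadratic q I f \<longleftrightarrow>
     (\<exists>b a. affine_form I a \<and>
        (\<forall>x\<in>cube I.
           [f x = (\<Sum>l<card I. \<Sum>j<l. b j l * x (var_idx I j) * x (var_idx I l)) + a x] (mod q)))"

text \<open>
  The vertices of the graph of a quadratic function in the variables \<open>I\<close> are the elements of \<open>I\<close>,
  and its edge labels are the coefficients \<open>b j l\<close> above. That it is a path in \<open>n\<close> vertices is by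
  definition a condition on the form of the function.
\<close>

definition graph_is_path :: "int \<Rightarrow> nat \<Rightarrow> nat set \<Rightarrow> ((nat \<Rightarrow> int) \<Rightarrow> int) \<Rightarrow> bool" where
  "graph_is_path q n I f \<longleftrightarrow>
     card I = n \<and>
     (n = 1 \<or>
      n \<ge> 2 \<and>
      (\<exists>p a. p permutes {..<n} \<and> affine_form I a \<and>
         (\<forall>x\<in>cube I.
            [f x = q div 2 * (\<Sum>\<alpha>=0..n-2. x (var_idx I (p \<alpha>)) * x (var_idx I (p (\<alpha> + 1)))) + a x]
              (mod q))))"

section \<open>Polyphase sequences, complementary sets and PMEPR\<close>

definition xi :: "int \<Rightarrow> complex" where
  "xi q = exp (2 * of_real pi * \<i> / of_int q)"

definition bin_point :: "nat \<Rightarrow> nat \<Rightarrow> (nat \<Rightarrow> int)" where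
  "bin_point m i = (\<lambda>\<alpha>\<in>{..<m}. of_bool (bit i \<alpha>))"

definition polyphase :: "int \<Rightarrow> nat \<Rightarrow> ((nat \<Rightarrow> int) \<Rightarrow> int) \<Rightarrow> complex list" where
  "polyphase q m f = map (\<lambda>i. xi q powi f (bin_point m i)) [0..<2 ^ m]"

definition polyphase_seq :: "int \<Rightarrow> nat \<Rightarrow> complex list \<Rightarrow> bool" where
  "polyphase_seq q n A \<longleftrightarrow> length A = n \<and> set A \<subseteq> range (\<lambda>e::int. xi q powi e)"

definition autocorr :: "complex list \<Rightarrow> int \<Rightarrow> complex" where
  "autocorr A l =
     (let n = int (length A) in
      if 0 \<le> l \<and> l < n then (\<Sum>i=0..n-l-1. A ! nat (i + l) * cnj (A ! nat i))
      else if - n < l \<and> l < 0 then (\<Sum>i=0..n+l-1. A ! nat i * cnj (A ! nat (i - l)))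
      else 0)"

definition complementary_set :: "nat \<Rightarrow> complex list set \<Rightarrow> bool" where
  "complementary_set N S \<longleftrightarrow>
     finite S \<and> card S = N \<and>
     (\<exists>n. \<forall>A\<in>S. length A = n) \<and>
     (\<forall>l. l \<noteq> 0 \<longrightarrow> (\<Sum>A\<in>S. autocorr A l) = 0)"

definition ofdm_signal :: "real \<Rightarrow> complex list \<Rightarrow> real \<Rightarrow> complex" where
  "ofdm_signal \<zeta> C \<theta> =
     (\<Sum>i<length C. C ! i * exp (2 * of_real pi * \<i> * of_real ((real i + \<zeta>) * \<theta>)))"

text \<open>
  The supremum is that of a bounded set, since \<open>\<bar>ofdm_signal \<zeta> C \<theta>\<bar>\<close> is at most the sum of the
  absolute values of the entries of \<open>C\<close>.
\<close>

definition pmepr :: "real \<Rightarrow> complex list \<Rightarrow> real" where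
  "pmepr \<zeta> C = (SUP \<theta>\<in>{0..<1}. (cmod (ofdm_signal \<zeta> C \<theta>))\<^sup>2) / real (length C)"

end

theory Submission
  imports Defs
begin

text \<open>
  Let \<open>e(x)\<close> be the first vertex of the path of the restriction of \<open>f\<close> that fixes the variables
  \<open>j \<alpha>\<close> at their values in \<open>x\<close>. The complementary set consists of the sequences of
  \<open>f + q/2 * ((\<Sum>\<alpha><k. c \<alpha> * x (j \<alpha>)) + c' * x (e(x)))\<close> with binary \<open>c \<alpha>\<close> and \<open>c'\<close>.
  Summing an autocorrelation over these signs leaves only the pairs of positions that agree in the
  restricted variables and in the start vertex of the path. Let \<open>e\<^sub>v\<close> be the first vertex along the
  path where such a pair differs. Flipping the variable \<open>e\<^bsub>v-1\<^esub>\<close> in both positions preserves their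
  distance and adds \<open>q/2\<close> to the difference of the values of \<open>f\<close>, so the terms cancel in pairs.
  The bound on the PMEPR holds since the powers of the signals of a complementary set of \<open>N\<close>
  unimodular sequences of length \<open>n\<close> add up to the constant \<open>N n\<close>.
\<close>

section \<open>Powers of the root of unity\<close>

lemma xi_powi: "xi q powi n = cis (2 * pi * (of_int n / of_int q))"
proof -
  have "xi q = cis (2 * pi / of_int q)"
    by (simp add: xi_def cis_conv_exp mult_ac)
  then show ?thesis
    by (simp add: cis_power_int mult_ac)
qed

lemma xi_nonzero [simp]: "xi q \<noteq> 0"
  by (simp add: xi_def)

lemma norm_xi_powi [simp]: "norm (xi q powi n) = 1"
  by (simp add: xi_powi)

lemma xi_powi_add: "xi q powi (a + b) = xi q powi a * xi q powi b"
  by (simp add: xi_powi cis_mult add_divide_distrib ring_distribs)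

lemma xi_powi_diff: "xi q powi (a - b) = xi q powi a * cnj (xi q powi b)"
  by (simp add: xi_powi cis_mult cis_cnj diff_divide_distrib ring_distribs)

lemma xi_powi_cong:
  assumes "q \<noteq> 0" "[a = b] (mod q)"
  shows "xi q powi a = xi q powi b"
proof -
  from assms(2) obtain t where "b = a + q * t"
    by (auto simp: cong_iff_lin)
  moreover have "xi q powi (q * t) = 1"
    using assms(1) by (simp add: xi_powi)
  ultimately show ?thesis
    by (simp add: xi_powi_add)
qed

lemma xi_powi_half:
  assumes "q \<noteq> 0" "even q"
  shows "xi q powi (q div 2 * z) = (- 1) powi z"
proof -
  from assms(2) obtain r where "q = 2 * r" ..
  then have "xi q powi (q div 2) = - 1"
    using assms(1) by (simp add: xi_powi)
  then show ?thesis
    by (simp add: power_int_mult)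
qed

section \<open>Autocorrelations as sums over pairs of positions\<close>

text \<open>Pairs of positions treat displacements of both signs uniformly and form the set on which
  the cancelling involution acts.\<close>

definition lag_pairs :: "nat \<Rightarrow> int \<Rightarrow> (nat \<times> nat) set" where
  "lag_pairs n l = {(a, b). a < n \<and> b < n \<and> int a - int b = l}"

lemma finite_lag_pairs [simp]: "finite (lag_pairs n l)"
  by (rule finite_subset[of _ "{..<n} \<times> {..<n}"]) (auto simp: lag_pairs_def)

lemma autocorr_eq_sum_lag_pairs:
  "autocorr A l = (\<Sum>(a, b)\<in>lag_pairs (length A) l. A ! a * cnj (A ! b))"
proof -
  define n where "n = int (length A)"
  consider "0 \<le> l" "l < n" | "- n < l" "l < 0" | "lag_pairs (length A) l = {}" "l \<ge> n \<or> l \<le> - n"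
    by (force simp: lag_pairs_def n_def)
  then show ?thesis
  proof cases
    case 1
    have "(\<Sum>i=0..n-l-1. A ! nat (i + l) * cnj (A ! nat i)) =
          (\<Sum>(a, b)\<in>lag_pairs (length A) l. A ! a * cnj (A ! b))"
      using 1
      by (intro sum.reindex_bij_witness[of _ "\<lambda>(a, b). int b" "\<lambda>i. (nat (i + l), nat i)"])
         (auto simp: lag_pairs_def n_def)
    then show ?thesis
      using 1 by (simp add: autocorr_def n_def)
  next
    case 2
    have "(\<Sum>i=0..n+l-1. A ! nat i * cnj (A ! nat (i - l))) =
          (\<Sum>(a, b)\<in>lag_pairs (length A) l. A ! a * cnj (A ! b))"
      using 2
      by (intro sum.reindex_bij_witness[of _ "\<lambda>(a, b). int a" "\<lambda>i. (nat i, nat (i - l))"])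
         (auto simp: lag_pairs_def n_def)
    then show ?thesis
      using 2 by (simp add: autocorr_def n_def)
  next
    case 3
    then show ?thesis
      by (auto simp: autocorr_def n_def Let_def)
  qed
qed

section \<open>Complementary sets bound the PMEPR\<close>

text \<open>Expanding the squared modulus gives a double sum over positions. The offset
  \<open>\<zeta>\<close> cancels in \<open>z a * cnj (z b)\<close>, whose phase depends only on the
  displacement, so the terms group by displacement.\<close>

lemma ofdm_signal_power_eq:
  fixes \<zeta> \<theta> :: real
  shows "complex_of_real ((cmod (ofdm_signal \<zeta> A \<theta>))\<^sup>2) =
         (\<Sum>l\<in>{- int (length A)<..<int (length A)}. autocorr A l * cis (2 * pi * (of_int l * \<theta>)))"
proof -
  define n where "n = length A"
  define z where "z i = cis (2 * pi * ((real i + \<zeta>) * \<theta>))" for i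
  have z: "z a * cnj (z b) = cis (2 * pi * (of_int (int a - int b) * \<theta>))" for a b
    by (simp add: z_def cis_mult cis_cnj algebra_simps)
  have "ofdm_signal \<zeta> A \<theta> = (\<Sum>i<n. A ! i * z i)"
    by (simp add: ofdm_signal_def n_def z_def cis_conv_exp mult_ac)
  then have "complex_of_real ((cmod (ofdm_signal \<zeta> A \<theta>))\<^sup>2) =
      (\<Sum>i<n. A ! i * z i) * (\<Sum>i<n. cnj (A ! i * z i))"
    by (simp add: complex_norm_square del: of_real_power)
  also have "\<dots> = (\<Sum>(a, b)\<in>{..<n} \<times> {..<n}. A ! a * cnj (A ! b) * (z a * cnj (z b)))"
    by (simp add: sum_product sum.cartesian_product mult_ac)
  also have "\<dots> = (\<Sum>l\<in>{- int n<..<int n}.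
      \<Sum>p\<in>{p\<in>{..<n} \<times> {..<n}. int (fst p) - int (snd p) = l}.
        (case p of (a, b) \<Rightarrow> A ! a * cnj (A ! b) * (z a * cnj (z b))))"
    by (rule sum.group[symmetric]) auto
  also have "\<dots> = (\<Sum>l\<in>{- int n<..<int n}.
      \<Sum>(a, b)\<in>lag_pairs n l. A ! a * cnj (A ! b) * cis (2 * pi * (of_int l * \<theta>)))"
    by (intro sum.cong refl) (auto simp: lag_pairs_def z)
  also have "\<dots> = (\<Sum>l\<in>{- int n<..<int n}. autocorr A l * cis (2 * pi * (of_int l * \<theta>)))"
    by (simp add: autocorr_eq_sum_lag_pairs n_def sum_distrib_right case_prod_unfold)
  finally show ?thesis
    by (simp add: n_def)
qed

lemma autocorr_0: "autocorr A 0 = of_real (\<Sum>i<length A. (cmod (A ! i))\<^sup>2)"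
proof -
  have "autocorr A 0 = (\<Sum>i<length A. A ! i * cnj (A ! i))"
    unfolding autocorr_eq_sum_lag_pairs
    by (rule sum.reindex_bij_witness[of _ "\<lambda>i. (i, i)" fst]) (auto simp: lag_pairs_def)
  then show ?thesis
    by (simp add: complex_norm_square del: of_real_power)
qed

text \<open>Complementarity kills every displacement except 0, where the phase factor is 1 and each
  sequence contributes its energy \<open>n\<close>.\<close>

lemma complementary_set_ofdm_power:
  assumes "complementary_set N S" "\<forall>A\<in>S. polyphase_seq q n A"
  shows "(\<Sum>A\<in>S. (cmod (ofdm_signal \<zeta> A \<theta>))\<^sup>2) = N * n"
proof -
  have len: "length A = n" if "A \<in> S" for A
    using assms(2) that by (auto simp: polyphase_seq_def)
  have cmod1: "cmod (A ! i) = 1" if "A \<in> S" "i < n" for A i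
  proof -
    have "A ! i \<in> range (\<lambda>e::int. xi q powi e)"
      using assms(2) that len[OF that(1)] nth_mem[of i A] unfolding polyphase_seq_def by blast
    then show ?thesis by auto
  qed
  have "complex_of_real (\<Sum>A\<in>S. (cmod (ofdm_signal \<zeta> A \<theta>))\<^sup>2) =
      (\<Sum>A\<in>S. \<Sum>l\<in>{- int n<..<int n}. autocorr A l * cis (2 * pi * (of_int l * \<theta>)))"
    unfolding of_real_sum by (intro sum.cong refl) (simp only: ofdm_signal_power_eq len)
  also have "\<dots> = (\<Sum>l\<in>{- int n<..<int n}. (\<Sum>A\<in>S. autocorr A l) * cis (2 * pi * (of_int l * \<theta>)))"
    by (subst sum.swap) (simp add: sum_distrib_right)
  also have "\<dots> = (\<Sum>l\<in>{- int n<..<int n}. if l = 0 then (\<Sum>A\<in>S. autocorr A 0) else 0)"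
    using assms(1) by (intro sum.cong refl) (auto simp: complementary_set_def)
  also have "\<dots> = (if n = 0 then 0 else \<Sum>A\<in>S. autocorr A 0)"
    by (simp add: sum.delta')
  also have "\<dots> = (\<Sum>A\<in>S. of_nat n)"
    using len by (auto simp: autocorr_0 cmod1 intro!: sum.cong)
  also have "\<dots> = complex_of_real (N * n)"
    using assms(1) by (simp add: complementary_set_def)
  finally show ?thesis
    by (simp only: of_real_eq_iff)
qed

text \<open>All powers are nonnegative, so each is bounded by their constant sum
  \<open>N * n\<close>; dividing by the length leaves \<open>N\<close>.\<close>

lemma complementary_set_pmepr_le:
  assumes "complementary_set N S" "\<forall>A\<in>S. polyphase_seq q n A" "C \<in> S" "n > 0"
  shows "pmepr \<zeta> C \<le> N"
proof -
  have "(cmod (ofdm_signal \<zeta> C \<theta>))\<^sup>2 \<le> N * n" for \<theta>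
  proof -
    have "(cmod (ofdm_signal \<zeta> C \<theta>))\<^sup>2 \<le> (\<Sum>A\<in>S. (cmod (ofdm_signal \<zeta> A \<theta>))\<^sup>2)"
      using assms(1,3) by (intro member_le_sum) (auto simp: complementary_set_def)
    then show ?thesis
      by (simp only: complementary_set_ofdm_power[OF assms(1,2)])
  qed
  then have "(SUP \<theta>\<in>{0..<1}. (cmod (ofdm_signal \<zeta> C \<theta>))\<^sup>2) \<le> N * n"
    by (intro cSUP_least) auto
  moreover have "length C = n"
    using assms(2,3) by (auto simp: polyphase_seq_def)
  ultimately show ?thesis
    using assms(4) by (simp add: pmepr_def divide_le_eq)
qed

section \<open>Flipping a vertex of a path\<close>

text \<open>Two positions with the same bit at \<open>w\<close> move by the same amount when it is
  flipped, so their distance is kept.\<close>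

lemma int_flip_bit:
  "int (flip_bit w a) = int a + (if bit a w then - (2 ^ w) else 2 ^ w)"
proof -
  have "flip_bit w x = x + (if bit x w then - (2 ^ w) else 2 ^ w)" for x :: int
    by (simp add: flip_bit_eq_if set_bit_eq unset_bit_eq)
  from this[of "int a"] show ?thesis
    by (simp only: of_nat_flip_bit_eq bit_of_nat_iff_bit)
qed

lemma less_exp_iff_bit: "a < 2 ^ m \<longleftrightarrow> (\<forall>i. bit a i \<longrightarrow> i < m)" for a :: nat
proof -
  have "a < 2 ^ m \<longleftrightarrow> take_bit m a = a"
    by (simp add: take_bit_nat_eq_self_iff)
  also have "\<dots> \<longleftrightarrow> (\<forall>i. bit a i \<longrightarrow> i < m)"
    by (auto simp: bit_eq_iff bit_take_bit_iff)
  finally show ?thesis .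
qed

lemma flip_bit_less_exp:
  fixes a :: nat
  assumes "a < 2 ^ m" "w < m"
  shows "flip_bit w a < 2 ^ m"
  using assms by (auto simp: less_exp_iff_bit bit_flip_bit_iff)

text \<open>\<open>e\<close> lists the vertices in path order. For \<open>n = 1\<close> the sum is
  empty, so a single vertex is covered too.\<close>

definition path_form :: "nat \<Rightarrow> (nat \<Rightarrow> nat) \<Rightarrow> (nat \<Rightarrow> int) \<Rightarrow> int" where
  "path_form n e z = (\<Sum>\<alpha><n-1. z (e \<alpha>) * z (e (Suc \<alpha>)))"

text \<open>The only edge on which the flip changes the difference is the one from \<open>e v\<close> to \<open>e (Suc v)\<close>.\<close>

lemma path_flip_odd:
  fixes x y :: "nat \<Rightarrow> int"
  assumes e: "inj_on e {..<n}" and v: "Suc v < n"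
    and eq: "\<And>\<alpha>. \<alpha> \<le> v \<Longrightarrow> x (e \<alpha>) = y (e \<alpha>)" and ne: "odd (x (e (Suc v)) - y (e (Suc v)))"
  shows "odd ((path_form n e (x(e v := 1 - x (e v))) - path_form n e (y(e v := 1 - y (e v)))) - (path_form n e x - path_form n e y))"
proof -
  define x' y' where "x' = x(e v := 1 - x (e v))" and "y' = y(e v := 1 - y (e v))"
  define t where "t \<alpha> = (x' (e \<alpha>) * x' (e (Suc \<alpha>)) - y' (e \<alpha>) * y' (e (Suc \<alpha>)))
      - (x (e \<alpha>) * x (e (Suc \<alpha>)) - y (e \<alpha>) * y (e (Suc \<alpha>)))" for \<alpha>
  have e_eq: "e \<alpha> = e v \<longleftrightarrow> \<alpha> = v" if "\<alpha> < n" for \<alpha>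
    using e v that by (auto simp: inj_on_def)
  have "(path_form n e x' - path_form n e y') - (path_form n e x - path_form n e y) = (\<Sum>\<alpha><n-1. t \<alpha>)"
    by (simp add: path_form_def t_def sum_subtractf)
  also have "\<dots> = (\<Sum>\<alpha>\<in>{v}. t \<alpha>)"
  proof (rule sum.mono_neutral_right)
    show "\<forall>\<alpha>\<in>{..<n-1} - {v}. t \<alpha> = 0"
    proof
      fix \<alpha> assume \<alpha>: "\<alpha> \<in> {..<n-1} - {v}"
      show "t \<alpha> = 0"
      \<comment> \<open>On the edge entering \<open>e v\<close>, \<open>x\<close> and
        \<open>y\<close> agree at both endpoints, before and after the flip, so the products
        cancel.\<close>
      proof (cases "Suc \<alpha> = v")
        case True
        then show ?thesis
          using \<alpha> eq[of v] eq[of \<alpha>] by (simp add: t_def x'_def y'_def e_eq)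
      next
        case False
        then show ?thesis
          using \<alpha> by (auto simp: t_def x'_def y'_def e_eq)
      qed
    qed
  qed (use v in auto)
  \<comment> \<open>The first factor is the change of the value at \<open>e v\<close> under the
    flip. It is odd, and so is the second factor by \<open>ne\<close>.\<close>
  also have "\<dots> = (1 - 2 * x (e v)) * (x (e (Suc v)) - y (e (Suc v)))"
    using v eq[of v] by (simp add: t_def x'_def y'_def e_eq algebra_simps)
  also have "odd \<dots>"
    using ne by simp
  finally show ?thesis
    unfolding x'_def y'_def .
qed

text \<open>Reindexing along \<open>\<phi>\<close> shows that the sum equals its own negative. Fixed
  points of \<open>\<phi>\<close> are allowed, since \<open>W\<close> vanishes there.\<close>

lemma sum_involution_neg:
  fixes W :: "'a \<Rightarrow> complex"
  assumes "\<And>p. p \<in> P \<Longrightarrow> \<phi> p \<in> P" "\<And>p. p \<in> P \<Longrightarrow> \<phi> (\<phi> p) = p" "\<And>p. p \<in> P \<Longrightarrow> W (\<phi> p) = - W p"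
  shows "(\<Sum>p\<in>P. W p) = 0"
proof -
  have "(\<Sum>p\<in>P. W p) = (\<Sum>p\<in>P. - W p)"
    using assms by (intro sum.reindex_bij_witness[of _ \<phi> \<phi>]) (auto simp: assms)
  then show ?thesis
    by (simp add: sum_negf)
qed


text \<open>Brings both cases of the path definition into one shape; for \<open>n \<ge> 2\<close>,
  \<open>e\<close> composes the increasing enumeration of \<open>I\<close> with the
  permutation.\<close>

lemma graph_is_path_form:
  assumes "card I = n" "n > 0" "quadratic q I f" "graph_is_path q n I f"
  shows "\<exists>e u c. bij_betw e {..<n} I \<and>
    (\<forall>x\<in>cube I. [f x = q div 2 * path_form n e x + ((\<Sum>i\<in>I. u i * x i) + c)] (mod q))"
proof -
  have fin: "finite I"
    using assms(1,2) card_ge_0_finite by blast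
  have bij: "bij_betw (var_idx I) {..<n} I"
    unfolding var_idx_def using assms(1) fin
    by (intro bij_betw_nth) (auto simp: lessThan_atLeast0)
  consider "n = 1" | p a where "n \<ge> 2" "p permutes {..<n}" "affine_form I a"
    "\<forall>x\<in>cube I. [f x = q div 2 * (\<Sum>\<alpha>=0..n-2. x (var_idx I (p \<alpha>)) * x (var_idx I (p (\<alpha> + 1)))) + a x] (mod q)"
    using assms(4) unfolding graph_is_path_def by blast
  then show ?thesis
  proof cases
    case 1
    \<comment> \<open>For one vertex the affine shape comes from \<open>quadratic\<close>, whose sum
      over pairs of variables is then empty.\<close>
    with assms(1,3) obtain a where
      "affine_form I a" "\<forall>x\<in>cube I. [f x = a x] (mod q)"
      unfolding quadratic_def by auto
    with 1 bij show ?thesis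
      unfolding affine_form_def
      by (intro exI[of _ "var_idx I"]) (fastforce simp: path_form_def)
  next
    case 2
    have "{0..n-2} = {..<n-1}"
      using 2 by auto
    then have "(\<Sum>\<alpha>=0..n-2. x (var_idx I (p \<alpha>)) * x (var_idx I (p (\<alpha> + 1)))) =
        path_form n (var_idx I \<circ> p) x" for x
      by (simp add: path_form_def)
    moreover have "bij_betw (var_idx I \<circ> p) {..<n} I"
      using bij 2(2) by (meson bij_betw_trans permutes_imp_bij)
    ultimately show ?thesis
      using 2(3,4) unfolding affine_form_def
      by (intro exI[of _ "var_idx I \<circ> p"]) fastforce
  qed
qed

section \<open>The cancelling involution\<close>

abbreviation bits :: "nat \<Rightarrow> nat \<Rightarrow> int" where
  "bits a \<equiv> \<lambda>i. of_bool (bit a i)"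

lemma bits_flip_bit: "bits (flip_bit w a) = (bits a)(w := 1 - bits a w)"
  by (auto simp: bit_flip_bit_iff)

text \<open>
  \<open>\<kappa> a\<close> encodes the bits of \<open>a\<close> at the restricted variables \<open>J\<close>. In a pair of positions that agree
  there and at the start of the path, both positions are flipped at the vertex before the first
  one where they differ: this keeps their distance and negates the term.
\<close>

lemma sum_lag_pairs_path_eq_0:
  fixes F :: "nat \<Rightarrow> int" and \<kappa> :: "nat \<Rightarrow> 'd" and e :: "'d \<Rightarrow> nat \<Rightarrow> nat"
  assumes q: "q \<noteq> 0" "even q" and l: "l \<noteq> 0"
    and \<kappa>: "\<And>a b. \<kappa> a = \<kappa> b \<longleftrightarrow> (\<forall>i\<in>J. bit a i = bit b i)"
    and e: "\<And>a. bij_betw (e (\<kappa> a)) {..<n} ({..<m} - J)"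
    and F: "\<And>a. a < 2 ^ m \<Longrightarrow> [F a = q div 2 * path_form n (e (\<kappa> a)) (bits a)
              + ((\<Sum>i\<in>{..<m} - J. u (\<kappa> a) i * bits a i) + c (\<kappa> a))] (mod q)"
  shows "(\<Sum>(a, b)\<in>lag_pairs (2 ^ m) l. xi q powi (F a - F b) *
           of_bool (\<kappa> a = \<kappa> b \<and> bit a (e (\<kappa> a) 0) = bit b (e (\<kappa> a) 0))) = 0"
proof -
  define agree where
    "agree = (\<lambda>(a :: nat, b :: nat). \<kappa> a = \<kappa> b \<and> bit a (e (\<kappa> a) 0) = bit b (e (\<kappa> a) 0))"
  \<comment> \<open>In a pair in \<open>agree\<close> the start vertex does not differ, so the
    search runs over successors, and \<open>v\<close> is already the index of the predecessor to be
    flipped.\<close>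
  define v where "v = (\<lambda>(a :: nat, b :: nat). LEAST v. bit a (e (\<kappa> a) (Suc v)) \<noteq> bit b (e (\<kappa> a) (Suc v)))"
  define w where "w = (\<lambda>(a, b :: nat). e (\<kappa> a) (v (a, b)))"
  \<comment> \<open>Pairs outside \<open>agree\<close> have weight 0 and stay fixed.\<close>
  define \<phi> where "\<phi> = (\<lambda>(a, b). if agree (a, b)
    then (flip_bit (w (a, b)) a, flip_bit (w (a, b)) b) else (a, b))"
  have v: "Suc (v (a, b)) < n" "bit a (e (\<kappa> a) (Suc (v (a, b)))) \<noteq> bit b (e (\<kappa> a) (Suc (v (a, b))))"
    "\<And>\<alpha>. \<alpha> \<le> v (a, b) \<Longrightarrow> bit a (e (\<kappa> a) \<alpha>) = bit b (e (\<kappa> a) \<alpha>)"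
    "w (a, b) \<in> {..<m} - J"
    if ab: "(a, b) \<in> lag_pairs (2 ^ m) l" "agree (a, b)" for a b
  proof -
    \<comment> \<open>As \<open>l \<noteq> 0\<close>, the positions differ in some bit. It lies
      outside \<open>J\<close> and is not at the start, so it is a vertex with a
      predecessor.\<close>
    have "a \<noteq> b" and less: "a < 2 ^ m" "b < 2 ^ m"
      using ab l by (auto simp: lag_pairs_def)
    then obtain i where i: "bit a i \<noteq> bit b i"
      using bit_eqI by blast
    have "i \<in> {..<m} - J"
      using i less ab(2) \<kappa> by (auto simp: less_exp_iff_bit agree_def)
    then obtain \<alpha> where \<alpha>: "\<alpha> < n" "i = e (\<kappa> a) \<alpha>"
      using e[of a] by (auto simp: bij_betw_def)
    with i ab(2) obtain \<beta> where \<beta>: "\<alpha> = Suc \<beta>"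
      by (cases \<alpha>) (auto simp: agree_def)
    let ?P = "\<lambda>v. bit a (e (\<kappa> a) (Suc v)) \<noteq> bit b (e (\<kappa> a) (Suc v))"
    have P: "?P \<beta>" using i \<alpha> \<beta> by simp
    show "?P (v (a, b))"
      using LeastI[of ?P, OF P] by (simp add: v_def)
    have "v (a, b) \<le> \<beta>"
      using Least_le[of ?P, OF P] by (simp add: v_def)
    then show v_less: "Suc (v (a, b)) < n"
      using \<alpha> \<beta> by simp
    then show "w (a, b) \<in> {..<m} - J"
      using e[of a] unfolding w_def by (auto simp: bij_betw_def)
    show "bit a (e (\<kappa> a) \<alpha>') = bit b (e (\<kappa> a) \<alpha>')" if "\<alpha>' \<le> v (a, b)" for \<alpha>'
    proof (cases \<alpha>')
      case 0
      then show ?thesis using ab(2) unfolding agree_def by auto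
    next
      case (Suc \<gamma>)
      then have "\<gamma> < v (a, b)" using that by simp
      then show ?thesis
        using not_less_Least[of \<gamma> ?P] Suc by (simp add: v_def)
    qed
  qed
  \<comment> \<open>The flipped vertex lies outside \<open>J\<close>, so the path and the
    coefficients selected by \<open>\<kappa>\<close> stay the same.\<close>
  have \<kappa>_flip: "\<kappa> (flip_bit (w (a, b)) a') = \<kappa> a'"
    if "(a, b) \<in> lag_pairs (2 ^ m) l" "agree (a, b)" for a b a'
    using v(4)[OF that] unfolding \<kappa> by (auto simp: bit_flip_bit_iff)
  have agree_flip: "agree (flip_bit (w (a, b)) a, flip_bit (w (a, b)) b)"
    and w_flip: "w (flip_bit (w (a, b)) a, flip_bit (w (a, b)) b) = w (a, b)"
    if "(a, b) \<in> lag_pairs (2 ^ m) l" "agree (a, b)" for a b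
  proof -
    \<comment> \<open>Flipping one bit in both positions preserves where they agree. Hence the flip
      leads to the same \<open>w\<close>, and a second flip undoes the first.\<close>
    have *: "bit (flip_bit (w (a, b)) a) i = bit (flip_bit (w (a, b)) b) i \<longleftrightarrow> bit a i = bit b i" for i
      by (auto simp: bit_flip_bit_iff)
    show "agree (flip_bit (w (a, b)) a, flip_bit (w (a, b)) b)"
      using that(2) unfolding agree_def prod.case \<kappa>_flip[OF that] * .
    have "v (flip_bit (w (a, b)) a, flip_bit (w (a, b)) b) = v (a, b)"
      unfolding v_def prod.case \<kappa>_flip[OF that] * ..
    then show "w (flip_bit (w (a, b)) a, flip_bit (w (a, b)) b) = w (a, b)"
      using \<kappa>_flip[OF that, of a] by (simp add: w_def)
  qed
  have mem_flip: "(flip_bit (w (a, b)) a, flip_bit (w (a, b)) b) \<in> lag_pairs (2 ^ m) l"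
    if ab: "(a, b) \<in> lag_pairs (2 ^ m) l" "agree (a, b)" for a b
  proof -
    have "bit a (w (a, b)) = bit b (w (a, b))"
      using v(3)[OF ab order_refl] by (simp add: w_def)
    then show ?thesis
      using v(4)[OF ab] ab(1) by (auto simp: lag_pairs_def int_flip_bit intro!: flip_bit_less_exp)
  qed
  have neg: "xi q powi (F (flip_bit (w (a, b)) a) - F (flip_bit (w (a, b)) b)) = - (xi q powi (F a - F b))"
    if ab: "(a, b) \<in> lag_pairs (2 ^ m) l" "agree (a, b)" for a b
  proof -
    define a' b' where "a' = flip_bit (w (a, b)) a" and "b' = flip_bit (w (a, b)) b"
    define d where "d = \<kappa> a"
    have d: "\<kappa> a = d" "\<kappa> b = d" "\<kappa> a' = d" "\<kappa> b' = d"
      using ab(2) \<kappa>_flip[OF ab] by (auto simp: d_def agree_def a'_def b'_def)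
    have less: "a < 2 ^ m" "b < 2 ^ m" "a' < 2 ^ m" "b' < 2 ^ m"
      using ab(1) mem_flip[OF ab] by (auto simp: lag_pairs_def a'_def b'_def)
    define H where "H z = path_form n (e d) (bits z)" for z
    define L where "L z = (\<Sum>i\<in>{..<m} - J. u d i * bits z i)" for z
    have F': "[F z = q div 2 * H z + (L z + c d)] (mod q)" if "z < 2 ^ m" "\<kappa> z = d" for z
      using F[OF that(1)] that(2) by (simp add: H_def L_def)
    have w: "bit a (w (a, b)) = bit b (w (a, b))"
      using v(3)[OF ab order_refl] by (simp add: w_def)
    \<comment> \<open>The two bits at \<open>w\<close> coincide before and after the flip, so that
      vertex contributes nothing to either difference.\<close>
    have "L a' - L b' = L a - L b"
      unfolding L_def sum_subtractf[symmetric]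
      using w by (intro sum.cong refl) (auto simp: a'_def b'_def bit_flip_bit_iff)
    then have "(q div 2 * H a' + (L a' + c d)) - (q div 2 * H b' + (L b' + c d))
        = (q div 2 * H a + (L a + c d)) - (q div 2 * H b + (L b + c d))
          + q div 2 * ((H a' - H b') - (H a - H b))"
      by (simp add: algebra_simps)
    moreover have "[F a' - F b' = (q div 2 * H a' + (L a' + c d)) - (q div 2 * H b' + (L b' + c d))] (mod q)"
      "[(q div 2 * H a + (L a + c d)) - (q div 2 * H b + (L b + c d)) = F a - F b] (mod q)"
      using cong_diff[OF F'[OF less(3) d(3)] F'[OF less(4) d(4)]]
        cong_sym[OF cong_diff[OF F'[OF less(1) d(1)] F'[OF less(2) d(2)]]] .
    ultimately have "[F a' - F b' = F a - F b + q div 2 * ((H a' - H b') - (H a - H b))] (mod q)"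
      using cong_trans[OF _ cong_add[OF _ cong_refl]] by simp
    then have "xi q powi (F a' - F b') = xi q powi (F a - F b) * (- 1) powi ((H a' - H b') - (H a - H b))"
      using q by (simp add: xi_powi_cong xi_powi_add xi_powi_half)
    moreover have "odd ((H a' - H b') - (H a - H b))"
      unfolding H_def a'_def b'_def bits_flip_bit
      unfolding w_def prod.case d_def
      using v[OF ab] e[of a]
      by (intro path_flip_odd) (auto simp: bij_betw_def)
    ultimately show ?thesis
      by (simp add: a'_def b'_def power_int_minus_left_odd)
  qed
  have "(\<Sum>(a, b)\<in>lag_pairs (2 ^ m) l. xi q powi (F a - F b) * of_bool (agree (a, b))) = 0"
  proof (rule sum_involution_neg[of _ \<phi>])
    fix p assume p: "p \<in> lag_pairs (2 ^ m) l"
    obtain a b where ab: "p = (a, b)"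
      by (cases p)
    show "\<phi> p \<in> lag_pairs (2 ^ m) l"
      using p by (simp add: ab \<phi>_def mem_flip)
    show "\<phi> (\<phi> p) = p"
      using p by (auto simp: ab \<phi>_def agree_flip w_flip bit_eq_iff bit_flip_bit_iff)
    show "(case \<phi> p of (a, b) \<Rightarrow> xi q powi (F a - F b) * of_bool (agree (a, b))) =
          - (case p of (a, b) \<Rightarrow> xi q powi (F a - F b) * of_bool (agree (a, b)))"
      using p by (simp add: ab \<phi>_def agree_flip neg)
  qed
  then show ?thesis
    by (simp only: agree_def prod.case)
qed

section \<open>The complementary set\<close>

text \<open>Each subset \<open>T\<close> of \<open>A\<close> gives a sequence modified by the signs
  \<open>s \<alpha>\<close>, \<open>\<alpha> \<in> T\<close>. \<open>separated\<close> makes these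
  sequences distinct, so the set has full size; \<open>cancel\<close> handles what summing over
  \<open>T\<close> leaves of the autocorrelations.\<close>

lemma complementary_set_of_signs:
  fixes F :: "nat \<Rightarrow> int" and g :: "'i \<Rightarrow> nat \<Rightarrow> bool"
  assumes q: "q \<noteq> 0" "even q" and A: "finite A"
    and cancel: "\<And>l. l \<noteq> 0 \<Longrightarrow> (\<Sum>(a, b)\<in>lag_pairs n l. xi q powi (F a - F b) *
                   of_bool (\<forall>\<alpha>\<in>A. g \<alpha> a = g \<alpha> b)) = 0"
    and separated: "\<And>\<alpha>. \<alpha> \<in> A \<Longrightarrow> \<exists>a<n. \<forall>\<beta>\<in>A. g \<beta> a \<longleftrightarrow> \<beta> = \<alpha>"
  shows "\<exists>S. complementary_set (2 ^ card A) S \<and> (\<forall>X\<in>S. polyphase_seq q n X) \<and>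
             map (\<lambda>a. xi q powi F a) [0..<n] \<in> S"
proof -
  define h where "h T a = F a + q div 2 * int (\<Sum>\<alpha>\<in>T. of_bool (g \<alpha> a))" for T a
  define B where "B T = map (\<lambda>a. xi q powi h T a) [0..<n]" for T
  define s :: "'i \<Rightarrow> nat \<Rightarrow> complex" where "s \<alpha> a = (- 1) ^ of_bool (g \<alpha> a)" for \<alpha> a
  have h: "xi q powi h T a = xi q powi F a * (\<Prod>\<alpha>\<in>T. s \<alpha> a)" for T a
    by (simp only: h_def xi_powi_add xi_powi_half[OF q] power_int_of_nat power_sum s_def)
  have len: "length (B T) = n" for T
    by (simp add: B_def)
  have nth: "B T ! a = xi q powi F a * (\<Prod>\<alpha>\<in>T. s \<alpha> a)" if "a < n" for T a
    using that by (simp add: B_def h)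
  have inj: "inj_on B (Pow A)"
  proof (rule inj_onI)
    fix T U assume TU: "T \<in> Pow A" "U \<in> Pow A" "B T = B U"
    have "\<alpha> \<in> T \<longleftrightarrow> \<alpha> \<in> U" if "\<alpha> \<in> A" for \<alpha>
    proof -
      \<comment> \<open>At a position where only \<open>g \<alpha>\<close> holds, the product of
        signs tells whether \<open>\<alpha>\<close> belongs to the subset.\<close>
      from separated[OF that] obtain a where a: "a < n" "\<forall>\<beta>\<in>A. g \<beta> a \<longleftrightarrow> \<beta> = \<alpha>"
        by blast
      have "(\<Prod>\<beta>\<in>V. s \<beta> a) = (if \<alpha> \<in> V then - 1 else 1)" if V: "V \<in> Pow A" for V
      proof -
        have "(\<Prod>\<beta>\<in>V. s \<beta> a) = (\<Prod>\<beta>\<in>V. if \<alpha> = \<beta> then - 1 else 1)"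
          using V a(2) by (intro prod.cong) (auto simp: s_def)
        then show ?thesis
          using A V by (auto simp: prod.delta' finite_subset)
      qed
      moreover have "(\<Prod>\<beta>\<in>T. s \<beta> a) = (\<Prod>\<beta>\<in>U. s \<beta> a)"
        using nth[OF a(1), of T] nth[OF a(1), of U] TU(3) by simp
      ultimately show ?thesis
        using TU(1,2) by (simp split: if_splits)
    qed
    then show "T = U"
      using TU(1,2) by blast
  qed
  have "(\<Sum>X\<in>B ` Pow A. autocorr X l) = 0" if l: "l \<noteq> 0" for l
  proof -
    have sum_signs: "(\<Sum>T\<in>Pow A. \<Prod>\<alpha>\<in>T. s \<alpha> a * s \<alpha> b) =
        2 ^ card A * of_bool (\<forall>\<alpha>\<in>A. g \<alpha> a = g \<alpha> b)" for a b
    proof -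
      \<comment> \<open>The sum over subsets factors over \<open>A\<close>, and a factor vanishes
        where the two signs differ.\<close>
      have "(\<Sum>T\<in>Pow A. \<Prod>\<alpha>\<in>T. s \<alpha> a * s \<alpha> b) = (\<Prod>\<alpha>\<in>A. s \<alpha> a * s \<alpha> b + 1)"
        using prod_add[OF A, of "\<lambda>\<alpha>. s \<alpha> a * s \<alpha> b" "\<lambda>_. 1"] by simp
      also have "\<dots> = (\<Prod>\<alpha>\<in>A. if g \<alpha> a = g \<alpha> b then 2 else 0)"
        by (intro prod.cong) (auto simp: s_def)
      also have "\<dots> = 2 ^ card A * of_bool (\<forall>\<alpha>\<in>A. g \<alpha> a = g \<alpha> b)"
        using A by (cases "\<forall>\<alpha>\<in>A. g \<alpha> a = g \<alpha> b") auto
      finally show ?thesis .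
    qed
    have "(\<Sum>X\<in>B ` Pow A. autocorr X l) =
        (\<Sum>T\<in>Pow A. \<Sum>(a, b)\<in>lag_pairs n l. B T ! a * cnj (B T ! b))"
      by (simp add: sum.reindex[OF inj] autocorr_eq_sum_lag_pairs len)
    also have "\<dots> = (\<Sum>T\<in>Pow A. \<Sum>(a, b)\<in>lag_pairs n l.
        xi q powi (F a - F b) * (\<Prod>\<alpha>\<in>T. s \<alpha> a * s \<alpha> b))"
      by (intro sum.cong refl)
         (auto simp: lag_pairs_def nth xi_powi_diff prod.distrib s_def cnj_prod mult_ac)
    also have "\<dots> = (\<Sum>(a, b)\<in>lag_pairs n l.
        xi q powi (F a - F b) * (\<Sum>T\<in>Pow A. \<Prod>\<alpha>\<in>T. s \<alpha> a * s \<alpha> b))"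
      by (subst sum.swap) (simp add: sum_distrib_left case_prod_unfold)
    also have "\<dots> = 2 ^ card A * (\<Sum>(a, b)\<in>lag_pairs n l.
        xi q powi (F a - F b) * of_bool (\<forall>\<alpha>\<in>A. g \<alpha> a = g \<alpha> b))"
      unfolding sum_signs sum_distrib_left by (intro sum.cong) (auto simp: mult_ac)
    finally show ?thesis
      using cancel[OF l] by simp
  qed
  then have "complementary_set (2 ^ card A) (B ` Pow A)"
    using A by (auto simp: complementary_set_def card_image[OF inj] card_Pow len)
  moreover have "\<forall>X\<in>B ` Pow A. polyphase_seq q n X"
    by (auto simp: polyphase_seq_def B_def)
  moreover have "B {} = map (\<lambda>a. xi q powi F a) [0..<n]"
    by (simp add: B_def h_def)
  then have "map (\<lambda>a. xi q powi F a) [0..<n] \<in> B ` Pow A"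
    by (metis Pow_bottom imageI)
  ultimately show ?thesis
    by blast
qed

theorem theorem5:
  fixes q :: int and m k :: nat and j :: "nat \<Rightarrow> nat"
    and f :: "(nat \<Rightarrow> int) \<Rightarrow> int" and \<zeta> :: real
  assumes "q \<ge> 2" and "even q" and "m > k"
    and "strict_mono_on {..<k} j" and "j ` {..<k} \<subseteq> {..<m}"
    and "gen_bool_fun q {..<m} f"
    and "\<And>d. d \<in> cube {..<k} \<Longrightarrow>
           quadratic q ({..<m} - j ` {..<k}) (restrict_vars k j d f) \<and>
           graph_is_path q (m - k) ({..<m} - j ` {..<k}) (restrict_vars k j d f)"
    and "\<zeta> > 0"
  shows "(\<exists>S. complementary_set (2 ^ (k + 1)) S \<and> (\<forall>A\<in>S. polyphase_seq q (2 ^ m) A) \<and>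
              polyphase q m f \<in> S) \<and>
         pmepr \<zeta> (polyphase q m f) \<le> 2 ^ (k + 1)"
proof -
  define n where "n = m - k"
  define I where "I = {..<m} - j ` {..<k}"
  define F where "F a = f (bin_point m a)" for a
  \<comment> \<open>\<open>\<kappa> a\<close> is the point at which the restricted variables are
    fixed; it selects the path used at position \<open>a\<close>.\<close>
  define \<kappa> where "\<kappa> a = (\<lambda>\<alpha>\<in>{..<k}. of_bool (bit a (j \<alpha>)) :: int)" for a :: nat
  have inj: "inj_on j {..<k}"
    using assms(4) by (rule strict_mono_on_imp_inj_on)
  have n: "card I = n" "n > 0"
    using assms(3,5) inj by (auto simp: I_def n_def card_Diff_subset card_image)
  have "\<forall>d\<in>cube {..<k}. \<exists>e u c. bij_betw e {..<n} I \<and>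
    (\<forall>x\<in>cube I. [restrict_vars k j d f x =
       q div 2 * path_form n e x + ((\<Sum>i\<in>I. u i * x i) + c)] (mod q))"
    using assms(7) graph_is_path_form[OF n] by (simp add: I_def n_def)
  then obtain e u c where bij_cube: "\<And>d. d \<in> cube {..<k} \<Longrightarrow> bij_betw (e d) {..<n} I"
    and form: "\<And>d x. d \<in> cube {..<k} \<Longrightarrow> x \<in> cube I \<Longrightarrow>
      [restrict_vars k j d f x =
       q div 2 * path_form n (e d) x + ((\<Sum>i\<in>I. u d i * x i) + c d)] (mod q)"
    by metis
  have \<kappa>_cube: "\<kappa> a \<in> cube {..<k}" for a
    by (auto simp: \<kappa>_def cube_def)
  note bij = bij_cube[OF \<kappa>_cube]
  have \<kappa>_eq: "\<kappa> a = \<kappa> b \<longleftrightarrow> (\<forall>i\<in>j ` {..<k}. bit a i = bit b i)" for a b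
    by (auto simp: \<kappa>_def restrict_def fun_eq_iff)
  have F: "[F a = q div 2 * path_form n (e (\<kappa> a)) (bits a)
      + ((\<Sum>i\<in>I. u (\<kappa> a) i * bits a i) + c (\<kappa> a))] (mod q)" for a
  proof -
    let ?x = "restrict (bits a) I"
    \<comment> \<open>Substituting \<open>\<kappa> a\<close> back into the remaining bits restores
      the point of position \<open>a\<close>, so \<open>F a\<close> inherits the form of that
      restriction.\<close>
    have "(\<lambda>i. if i \<in> j ` {..<k} then \<kappa> a (inv_into {..<k} j i) else ?x i) = bin_point m a"
      using assms(5) inj by (fastforce simp: \<kappa>_def I_def bin_point_def)
    then have "restrict_vars k j (\<kappa> a) f ?x = F a"
      by (simp add: restrict_vars_def F_def)
    moreover have "path_form n (e (\<kappa> a)) ?x = path_form n (e (\<kappa> a)) (bits a)"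
      using bij_betwE[OF bij[of a]] by (auto simp: path_form_def intro!: sum.cong)
    moreover have "?x \<in> cube I"
      by (auto simp: cube_def)
    ultimately show ?thesis
      using form[OF \<kappa>_cube, of ?x a] by simp
  qed
  \<comment> \<open>Index \<open>k\<close> stands for the start vertex of the path, which may vary
    with the restricted bits.\<close>
  define g where "g \<alpha> a \<longleftrightarrow> bit a (if \<alpha> < k then j \<alpha> else e (\<kappa> a) 0)" for \<alpha> a
  have agree_iff: "(\<forall>\<alpha>\<in>{..k}. g \<alpha> a = g \<alpha> b) \<longleftrightarrow> \<kappa> a = \<kappa> b \<and> bit a (e (\<kappa> a) 0) = bit b (e (\<kappa> a) 0)" for a b
  proof -
    have "(\<forall>\<alpha>\<in>{..k}. g \<alpha> a = g \<alpha> b) \<longleftrightarrow>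
        (\<forall>\<alpha>\<in>{..<k}. g \<alpha> a = g \<alpha> b) \<and> g k a = g k b"
      by (auto simp: le_less)
    also have "(\<forall>\<alpha>\<in>{..<k}. g \<alpha> a = g \<alpha> b) \<longleftrightarrow> \<kappa> a = \<kappa> b"
      by (auto simp: g_def \<kappa>_eq)
    \<comment> \<open>Once \<open>\<kappa> a = \<kappa> b\<close>, both positions have the same
      start vertex, so \<open>g k\<close> reads the same bit in both.\<close>
    finally show ?thesis
      unfolding g_def by auto
  qed
  have separated: "\<exists>a<2 ^ m. \<forall>\<beta>\<in>{..k}. g \<beta> a \<longleftrightarrow> \<beta> = \<alpha>" if "\<alpha> \<in> {..k}" for \<alpha>
  proof -
    \<comment> \<open>The witness \<open>2 ^ i\<close> has a single 1 bit: at
      \<open>j \<alpha>\<close>, or for \<open>\<alpha> = k\<close> at the start of the path for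
      restricted variables all 0.\<close>
    define i where "i = (if \<alpha> < k then j \<alpha> else e (\<kappa> 0) 0)"
    have start: "e (\<kappa> a) 0 \<in> I" for a
      using bij_betwE[OF bij] n(2) by auto
    have "g \<beta> (2 ^ i) \<longleftrightarrow> \<beta> = \<alpha>" if "\<beta> \<le> k" for \<beta>
    proof (cases "\<alpha> < k")
      case True
      then show ?thesis
        using that inj start[of "2 ^ j \<alpha>"]
        by (auto simp: g_def i_def bit_exp_iff I_def inj_on_def)
    next
      case False
      then have i: "i = e (\<kappa> 0) 0" "i \<notin> j ` {..<k}"
        using start[of 0] by (auto simp: i_def I_def)
      \<comment> \<open>This bit lies outside the restricted variables, so setting it does not
        change the path whose start it marks.\<close>
      then have "\<kappa> (2 ^ i) = \<kappa> 0"
        unfolding \<kappa>_eq by (metis bit_exp_iff bit_0_eq bot_apply bot_bool_def)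
      moreover have "i \<noteq> j \<beta>" if "\<beta> < k"
        using i(2) that by blast
      ultimately show ?thesis
        using False that \<open>\<alpha> \<in> {..k}\<close> i(1) by (auto simp: g_def bit_exp_iff)
    qed
    moreover have "i < m"
      using start[of 0] assms(5) by (auto simp: i_def I_def)
    ultimately show ?thesis
      by (intro exI[of _ "2 ^ i"]) auto
  qed
  have "(\<Sum>(a, b)\<in>lag_pairs (2 ^ m) l. xi q powi (F a - F b) *
      of_bool (\<forall>\<alpha>\<in>{..k}. g \<alpha> a = g \<alpha> b)) = 0" if "l \<noteq> 0" for l
    unfolding agree_iff
    using sum_lag_pairs_path_eq_0[of q l \<kappa> "j ` {..<k}" e n m F u c] that assms(1,2) \<kappa>_eq bij F
    by (simp add: I_def)
  then have "\<exists>S. complementary_set (2 ^ card {..k}) S \<and> (\<forall>A\<in>S. polyphase_seq q (2 ^ m) A) \<and>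
      map (\<lambda>a. xi q powi F a) [0..<2 ^ m] \<in> S"
    using assms(1,2) separated by (intro complementary_set_of_signs) auto
  then obtain S where S: "complementary_set (2 ^ (k + 1)) S"
    "\<forall>A\<in>S. polyphase_seq q (2 ^ m) A" "polyphase q m f \<in> S"
    by (auto simp: polyphase_def F_def)
  with complementary_set_pmepr_le[OF S] show ?thesis
    by auto
qed

end
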